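(* Let $K \subseteq L$ be fields and let $A \in \theta(K,L)$. Suppose that for every $a \in A$, the field $K$ contains all $n_a$th roots of unity. Then $A$ is linearly independent over $K$.
   Context: For fields $K \subseteq L$, a set $A$ belongs to $\theta(K,L)$ if and only if all five of the following hold: (i) $A \subseteq L$; (ii) $|A| \geqslant 2$ ($A$ may be infinite); (iii) for every $a \in A$ there is some $n \in \mathbb{N}=\{1,2,\dots\}$ with $a^{n} \in K$, and $n_a$ denotes the minimal such $n$; (iv) $A$ is pairwise linearly independent over $K$ (every two distinct elements of $A$ are linearly independent over $K$); (v) if $\operatorname{char}(K)>0$ then $\gcd(n_a,\operatorname{char}(K))=1$ for all $a \in A$. *)

theory Defs
  imports "HOL-Algebra.Algebraic_Closure"
begin

(* Analogue of CHAR for rings given as records: 0 if no positive multiple of one vanishes. *)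
definition ring_char :: "('a, 'b) ring_scheme \<Rightarrow> nat" where
  "ring_char R =
    (if \<exists>n::nat. n > 0 \<and> [n] \<cdot>\<^bsub>R\<^esub> \<one>\<^bsub>R\<^esub> = \<zero>\<^bsub>R\<^esub>
     then LEAST n::nat. n > 0 \<and> [n] \<cdot>\<^bsub>R\<^esub> \<one>\<^bsub>R\<^esub> = \<zero>\<^bsub>R\<^esub>
     else 0)"

definition root_degree :: "'a set \<Rightarrow> ('a, 'b) ring_scheme \<Rightarrow> 'a \<Rightarrow> nat" where
  "root_degree K L a = (LEAST n::nat. n \<ge> 1 \<and> a [^]\<^bsub>L\<^esub> n \<in> K)"

(* The library predicate independent works on lists; a possibly infinite set is independent
   iff every finite list of distinct elements drawn from it is. *)
definition lin_independent_set :: "'a set \<Rightarrow> ('a, 'b) ring_scheme \<Rightarrow> 'a set \<Rightarrow> bool" where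
  "lin_independent_set K L A \<longleftrightarrow>
    (\<forall>xs. distinct xs \<and> set xs \<subseteq> A \<longrightarrow> ring.independent L K xs)"

definition theta :: "'a set \<Rightarrow> ('a, 'b) ring_scheme \<Rightarrow> 'a set set" where
  "theta K L = {A.
     A \<subseteq> carrier L \<and>
     (infinite A \<or> card A \<ge> 2) \<and>
     (\<forall>a\<in>A. \<exists>n::nat. n \<ge> 1 \<and> a [^]\<^bsub>L\<^esub> n \<in> K) \<and>
     (\<forall>a\<in>A. \<forall>b\<in>A. a \<noteq> b \<longrightarrow> ring.independent L K [a, b]) \<and>
     (ring_char (L\<lparr>carrier := K\<rparr>) > 0 \<longrightarrow>
       (\<forall>a\<in>A. gcd (root_degree K L a) (ring_char (L\<lparr>carrier := K\<rparr>)) = 1))}"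

(* The n-th roots of unity are taken in an algebraic closure, not just in L; L (hence K)
   is embedded into field.alg_closure L by ring.indexed_const L. *)
definition contains_roots_of_unity :: "'a set \<Rightarrow> ('a, 'b) ring_scheme \<Rightarrow> nat \<Rightarrow> bool" where
  "contains_roots_of_unity K L n \<longleftrightarrow>
    (\<forall>\<zeta> \<in> carrier (field.alg_closure L).
       \<zeta> [^]\<^bsub>field.alg_closure L\<^esub> n = \<one>\<^bsub>field.alg_closure L\<^esub> \<longrightarrow>
       \<zeta> \<in> ring.indexed_const L ` K)"

end

theory Submission
  imports Defs
begin

text \<open>
  Only finitely many elements of \<open>A\<close> occur in a linear relation, and all of them have their
  \<open>N\<close>-th power in \<open>K\<close>, where \<open>N\<close> is the least common multiple of their degrees; \<open>K\<close> contains
  \<open>N\<close> distinct \<open>N\<close>-th roots of unity. Call \<open>F \<supseteq> K\<close> good if pairwise non-proportional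
  elements of \<open>F\<close> with \<open>N\<close>-th power in \<open>K\<close> are linearly independent over \<open>K\<close>. The field \<open>K\<close> is
  trivially good, and it remains to pass from a good \<open>F\<close> to \<open>F(a)\<close> with \<open>a^N\<close> in \<open>K\<close>. Every
  \<open>F\<close>-homomorphism of \<open>F(a)\<close> into \<open>L\<close> multiplies each member of a relation by an \<open>N\<close>-th root of
  unity, which lies in \<open>K\<close>. In a minimal relation these factors agree, as otherwise subtracting a
  multiple of the relation from its image gives a shorter one. So the ratios of the members are
  fixed by all \<open>F\<close>-homomorphisms, hence lie in \<open>F\<close>: the minimal polynomial of \<open>a\<close> over \<open>F\<close> splits
  in \<open>L\<close> with distinct roots, because it divides \<open>X^N - a^N\<close>. Dividing the relation by one of its
  members contradicts that \<open>F\<close> is good.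
\<close>

subsection \<open>Radical polynomials and roots of unity\<close>

lemma (in domain) nat_pow_nonzero:
  fixes n :: nat
  assumes "x \<in> carrier R" "x \<noteq> \<zero>"
  shows "x [^] n \<noteq> \<zero>"
  using assms by (induction n) (auto simp: integral_iff)

lemma (in domain) poly_of_const_closed:
  assumes "z \<in> carrier R" shows "poly_of_const z \<in> carrier (poly_ring R)"
  using assms by (simp add: poly_of_const_def univ_poly_def polynomial_def)

text \<open>Multiplicities of roots are stated with the coefficient list of the linear factor, while
  identities in the polynomial ring need it as a difference.\<close>

lemma (in domain) monic_linear_eq:
  assumes "z \<in> carrier R"
  shows "[\<one>, \<ominus> z] = X \<ominus>\<^bsub>poly_ring R\<^esub> poly_of_const z"
proof -
  have "X \<ominus>\<^bsub>poly_ring R\<^esub> poly_of_const z = poly_add [\<one>, \<zero>] (map (a_inv R) (poly_of_const z))"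
    unfolding a_minus_def univ_poly_a_inv_def'[OF carrier_is_subring poly_of_const_closed[OF assms]]
      univ_poly_add var_def by simp
  thus ?thesis using assms by (auto simp: poly_of_const_def)
qed

lemma (in domain) eval_poly_of_const:
  assumes "z \<in> carrier R" "a \<in> carrier R" shows "eval (poly_of_const z) a = z"
  using assms by (simp add: poly_of_const_def)

definition (in ring) radical_poly :: "nat \<Rightarrow> 'a \<Rightarrow> 'a list" where
  "radical_poly n c = X [^]\<^bsub>poly_ring R\<^esub> n \<ominus>\<^bsub>poly_ring R\<^esub> poly_of_const c"

lemma (in domain) radical_poly:
  assumes "c \<in> carrier R"
  shows "radical_poly n c \<in> carrier (poly_ring R)"
    and "n > 0 \<Longrightarrow> degree (radical_poly n c) = n"
    and "a \<in> carrier R \<Longrightarrow> eval (radical_poly n c) a = a [^] n \<ominus> c"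
proof -
  interpret P: domain "poly_ring R" using univ_poly_is_domain[OF carrier_is_subring] .
  note X = var_closed(1)[OF carrier_is_subring]
  note C = poly_of_const_closed[OF assms]
  show "radical_poly n c \<in> carrier (poly_ring R)"
    unfolding radical_poly_def using X C by simp
  { assume n: "n > 0"
    have d: "degree (X [^]\<^bsub>poly_ring R\<^esub> n) = n"
      using polynomial_pow_degree[OF X] by (simp add: var_def)
    have d': "degree (\<ominus>\<^bsub>poly_ring R\<^esub> poly_of_const c) = 0"
      unfolding univ_poly_a_inv_degree[OF carrier_is_subring C] by (simp add: poly_of_const_def)
    have "degree (radical_poly n c) = max n 0"
      unfolding radical_poly_def a_minus_def univ_poly_add
      using poly_add_degree_eq[OF carrier_is_subring, of "X [^]\<^bsub>poly_ring R\<^esub> n" "\<ominus>\<^bsub>poly_ring R\<^esub> poly_of_const c"]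
       d d' n X C by (simp add: univ_poly_carrier)
    thus "degree (radical_poly n c) = n" by simp }
  { assume a: "a \<in> carrier R"
    interpret E: ring_hom_cring "poly_ring R" R "\<lambda>p. eval p a"
      by (rule eval_cring_hom[OF carrier_is_subring a])
    show "eval (radical_poly n c) a = a [^] n \<ominus> c"
      unfolding radical_poly_def a_minus_def using X C eval_poly_of_const[OF assms a] eval_var[OF a]
      by simp }
qed

text \<open>The quotient \<open>s\<close> of \<open>X^n - z^n\<close> by \<open>X - z\<close> takes the value \<open>n z^(n-1)\<close> at \<open>z\<close>;
  multiplying by \<open>z\<close> avoids the truncated exponent.\<close>

lemma (in domain) radical_poly_quotient:
  assumes "z \<in> carrier R"
  shows "\<exists>s \<in> carrier (poly_ring R). radical_poly n (z [^] n) = [\<one>, \<ominus> z] \<otimes>\<^bsub>poly_ring R\<^esub> s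
    \<and> z \<otimes> eval s z = [n] \<cdot> (z [^] n)"
proof (induction n)
  interpret P: domain "poly_ring R" using univ_poly_is_domain[OF carrier_is_subring] .
  interpret E: ring_hom_cring "poly_ring R" R "\<lambda>p. eval p z"
    by (rule eval_cring_hom[OF carrier_is_subring assms])
  note X = var_closed(1)[OF carrier_is_subring]
  note C = poly_of_const_closed
  interpret Q: ring_hom_ring "R\<lparr>carrier := carrier R\<rparr>" "poly_ring R" poly_of_const
    by (rule canonical_embedding_ring_hom[OF carrier_is_subring])
  have lin: "[\<one>, \<ominus> z] \<in> carrier (poly_ring R)"
    unfolding monic_linear_eq[OF assms] using X C[OF assms] by simp
  {
    case 0
    have "radical_poly 0 \<one> = \<zero>\<^bsub>poly_ring R\<^esub>"
      unfolding radical_poly_def using Q.hom_one by (simp add: a_minus_def P.r_neg)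
    thus ?case using assms lin E.hom_zero by (intro bexI[of _ "\<zero>\<^bsub>poly_ring R\<^esub>"]) auto
  next
    case (Suc n)
    then obtain s where s: "s \<in> carrier (poly_ring R)"
      "radical_poly n (z [^] n) = [\<one>, \<ominus> z] \<otimes>\<^bsub>poly_ring R\<^esub> s" "z \<otimes> eval s z = [n] \<cdot> (z [^] n)" by blast
    \<comment> \<open>This comes from
      \<open>X^(n+1) - z^(n+1) = (X - z) X^n + z (X^n - z^n)\<close>, into which the factorization
      for \<open>n\<close> is inserted.\<close>
    define t where "t = X [^]\<^bsub>poly_ring R\<^esub> n \<oplus>\<^bsub>poly_ring R\<^esub> poly_of_const z \<otimes>\<^bsub>poly_ring R\<^esub> s"
    have t: "t \<in> carrier (poly_ring R)" unfolding t_def using X C[OF assms] s by simp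
    have ph: "poly_of_const (z [^] Suc n) = poly_of_const (z [^] n) \<otimes>\<^bsub>poly_ring R\<^esub> poly_of_const z"
      using Q.hom_mult[of "z [^] n" z] assms by simp
    have alg: "x [^]\<^bsub>poly_ring R\<^esub> Suc n \<ominus>\<^bsub>poly_ring R\<^esub> w \<otimes>\<^bsub>poly_ring R\<^esub> y
       = (x \<ominus>\<^bsub>poly_ring R\<^esub> y) \<otimes>\<^bsub>poly_ring R\<^esub> (x [^]\<^bsub>poly_ring R\<^esub> n) \<oplus>\<^bsub>poly_ring R\<^esub> y \<otimes>\<^bsub>poly_ring R\<^esub> (x [^]\<^bsub>poly_ring R\<^esub> n \<ominus>\<^bsub>poly_ring R\<^esub> w)"
      if "x \<in> carrier (poly_ring R)" "y \<in> carrier (poly_ring R)" "w \<in> carrier (poly_ring R)" for x y w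
    proof -
      have "x [^]\<^bsub>poly_ring R\<^esub> n \<in> carrier (poly_ring R)" using that by simp
      thus ?thesis unfolding P.nat_pow_Suc using that by algebra
    qed
    have "radical_poly (Suc n) (z [^] Suc n) = [\<one>, \<ominus> z] \<otimes>\<^bsub>poly_ring R\<^esub> (X [^]\<^bsub>poly_ring R\<^esub> n)
       \<oplus>\<^bsub>poly_ring R\<^esub> poly_of_const z \<otimes>\<^bsub>poly_ring R\<^esub> radical_poly n (z [^] n)"
      unfolding radical_poly_def ph monic_linear_eq[OF assms] using alg X C assms by simp
    also have "\<dots> = [\<one>, \<ominus> z] \<otimes>\<^bsub>poly_ring R\<^esub> t"
      unfolding s t_def using lin X C[OF assms] s(1) by (simp add: P.r_distr P.m_lcomm)
    finally have 1: "radical_poly (Suc n) (z [^] Suc n) = [\<one>, \<ominus> z] \<otimes>\<^bsub>poly_ring R\<^esub> t" .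
    have es: "eval s z \<in> carrier R" using E.hom_closed s(1) by blast
    have "eval t z = z [^] n \<oplus> z \<otimes> eval s z"
      unfolding t_def using s(1) X C[OF assms] eval_poly_of_const[OF assms assms] eval_var[OF assms]
        by simp
    hence "z \<otimes> eval t z = z [^] Suc n \<oplus> z \<otimes> ([n] \<cdot> (z [^] n))"
      using assms es s(3) by (simp add: r_distr m_comm)
    also have "\<dots> = [Suc n] \<cdot> (z [^] Suc n)"
      using assms by (simp add: add_pow_rdistr m_comm a_comm)
    finally show ?case using 1 t by blast
  }
qed

lemma (in field) card_roots_le_degree:
  assumes "p \<in> carrier (poly_ring R)" "p \<noteq> []" "Z \<subseteq> {z \<in> carrier R. eval p z = \<zero>}"
  shows "finite Z" and "card Z \<le> degree p"
proof -
  have s: "Z \<subseteq> set_mset (roots p)"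
    using assms roots_mem_iff_is_root[OF assms(1)] by (auto simp: is_root_def)
  thus "finite Z" by (rule finite_subset) simp
  have "card Z \<le> card (set_mset (roots p))" using s by (intro card_mono) auto
  also have "\<dots> \<le> size (roots p)"
    by (metis mset_set_set_mset_msubset size_mset_mono size_mset_set)
  also have "\<dots> \<le> degree p" by (rule size_roots_le_degree[OF assms(1)])
  finally show "card Z \<le> degree p" .
qed

text \<open>Every root is simple: for a root \<open>z\<close>, the cofactor \<open>s\<close> of
  \<open>X - z\<close> satisfies \<open>z s(z) = n\<close>, which is nonzero, whereas a double root
  would force \<open>s(z) = 0\<close>.\<close>

lemma (in field) card_roots_of_unity:
  assumes n: "n > 0" "[n] \<cdot> \<one> \<noteq> \<zero>" and sp: "splitted (radical_poly n \<one>)"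
  shows "card {z \<in> carrier R. z [^] n = \<one>} = n"
proof -
  interpret P: domain "poly_ring R" using univ_poly_is_domain[OF carrier_is_subring] .
  let ?p = "radical_poly n \<one>"
  note p = radical_poly[OF one_closed]
  have ne: "?p \<noteq> []" using p(2)[OF n(1)] n(1) by auto
  have root: "is_root ?p z \<longleftrightarrow> z \<in> carrier R \<and> z [^] n = \<one>" for z
    using p(3) ne by (auto simp: is_root_def)
  have simple: "count (roots ?p) z \<le> 1" for z
  proof (rule ccontr)
    assume "\<not> count (roots ?p) z \<le> 1"
    hence am: "2 \<le> alg_mult ?p z" using alg_mult_eq_count_roots[OF p(1)] by simp
    hence z: "z \<in> carrier R" "z [^] n = \<one>"
      using alg_mult_gt_zero_iff_is_root[OF p(1), of n z] root by auto
    let ?l = "[\<one>, \<ominus> z]"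
    have l: "?l \<in> carrier (poly_ring R)"
      unfolding monic_linear_eq[OF z(1)] using var_closed(1)[OF carrier_is_subring] poly_of_const_closed[OF z(1)]
        by simp
    have "(?l [^]\<^bsub>poly_ring R\<^esub> (2::nat)) pdivides ?p"
      by (rule le_alg_mult_imp_pdivides[OF z(1) p(1) am])
    then obtain q where q: "q \<in> carrier (poly_ring R)" "?p = (?l [^]\<^bsub>poly_ring R\<^esub> (2::nat)) \<otimes>\<^bsub>poly_ring R\<^esub> q"
      by (auto simp: pdivides_def factor_def)
    obtain s where s: "s \<in> carrier (poly_ring R)" "?p = ?l \<otimes>\<^bsub>poly_ring R\<^esub> s" "z \<otimes> eval s z = [n] \<cdot> \<one>"
      using radical_poly_quotient[OF z(1), of n] z(2) by auto
    have "?l \<otimes>\<^bsub>poly_ring R\<^esub> s = ?l \<otimes>\<^bsub>poly_ring R\<^esub> (?l \<otimes>\<^bsub>poly_ring R\<^esub> q)"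
      using s q l by (simp add: numeral_2_eq_2 P.m_assoc)
    hence sq: "s = ?l \<otimes>\<^bsub>poly_ring R\<^esub> q"
      using P.m_lcancel[of ?l s "?l \<otimes>\<^bsub>poly_ring R\<^esub> q"] l s(1) q(1) by (simp add: univ_poly_zero)
    interpret E: ring_hom_cring "poly_ring R" R "\<lambda>p. eval p z"
      by (rule eval_cring_hom[OF carrier_is_subring z(1)])
    have "eval s z = eval ?l z \<otimes> eval q z" unfolding sq using l q(1) by (rule E.hom_mult)
    moreover have "eval ?l z = \<zero>" using z(1) by (simp add: r_neg)
    ultimately have "eval s z = \<zero>" using q(1) E.hom_closed by simp
    thus False using s(3) z n(2) by simp
  qed
  \<comment> \<open>\<open>splitted\<close> counts roots with multiplicity; since all are simple, it
    counts distinct roots.\<close>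
  have "roots ?p = mset_set (set_mset (roots ?p))"
  proof (rule multiset_eqI)
    fix z show "count (roots ?p) z = count (mset_set (set_mset (roots ?p))) z"
      using simple[of z] by (cases "z \<in># roots ?p") (auto simp: count_mset_set le_antisym Suc_leI not_in_iff)
  qed
  hence "size (roots ?p) = card (set_mset (roots ?p))" by (metis size_mset_set)
  moreover have "set_mset (roots ?p) = {z \<in> carrier R. z [^] n = \<one>}"
    using roots_mem_iff_is_root[OF p(1)] root by auto
  ultimately show ?thesis using sp p(2)[OF n(1)] unfolding splitted_def by simp
qed

section \<open>Roots of unity in \<open>K\<close> for a common exponent\<close>

text \<open>A root of unity \<open>z\<close> of order dividing the lcm has two powers in
  \<open>K\<close>, namely \<open>z^(lcm/m)\<close> and \<open>z^(lcm/n)\<close>. These exponents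
  are coprime, so Bezout recovers \<open>z\<close> from the two powers.\<close>

lemma (in field) contains_roots_of_unity_lcm:
  assumes K: "subfield K R" and mn: "m > 0" "n > 0"
    and "contains_roots_of_unity K R m" "contains_roots_of_unity K R n"
  shows "contains_roots_of_unity K R (lcm m n)"
  unfolding contains_roots_of_unity_def
proof (intro ballI impI)
  interpret C: algebraic_closure alg_closure "indexed_const ` carrier R" by (rule alg_closureE(1))
  interpret H: ring_hom_ring R alg_closure indexed_const
    using ring_axioms C.ring_axioms alg_closureE(2) by (rule ring_hom_ringI2)
  have K': "subfield (indexed_const ` K) alg_closure"
    using H.img_is_subfield(2)[OF K C.one_not_zero] .
  fix z assume z: "z \<in> carrier alg_closure" "z [^]\<^bsub>alg_closure\<^esub> lcm m n = \<one>\<^bsub>alg_closure\<^esub>"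
  define u v where "u = n div gcd m n" and "v = m div gcd m n"
  have uv: "u * m = lcm m n" "v * n = lcm m n" "coprime u v" "u > 0"
    unfolding u_def v_def using mn div_gcd_coprime[of n m]
    by (auto simp: lcm_nat_def gcd.commute mult.commute div_mult_swap dvd_div_mult div_greater_zero_iff gcd_le2_nat)
  have "(z [^]\<^bsub>alg_closure\<^esub> u) [^]\<^bsub>alg_closure\<^esub> m = \<one>\<^bsub>alg_closure\<^esub>"
    "(z [^]\<^bsub>alg_closure\<^esub> v) [^]\<^bsub>alg_closure\<^esub> n = \<one>\<^bsub>alg_closure\<^esub>"
    using z uv by (simp_all add: C.nat_pow_pow)
  hence zK: "z [^]\<^bsub>alg_closure\<^esub> u \<in> indexed_const ` K" "z [^]\<^bsub>alg_closure\<^esub> v \<in> indexed_const ` K"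
    using assms(4,5) z(1) unfolding contains_roots_of_unity_def by blast+
  have pw: "w [^]\<^bsub>alg_closure\<^esub> (k::nat) \<in> indexed_const ` K" if "w \<in> indexed_const ` K" for w k
    by (induction k) (use subringE(3,6)[OF subfieldE(1)[OF K']] that in auto)
  obtain x y where xy: "u * x = v * y + 1" using bezout_nat[of u v] uv(3,4) by auto
  \<comment> \<open>Bezout over the naturals reads \<open>u x = v y + 1\<close>, so \<open>z\<close>
    is the quotient of \<open>z^(u x)\<close> by \<open>s = z^(v y)\<close>.\<close>
  define s where "s = (z [^]\<^bsub>alg_closure\<^esub> v) [^]\<^bsub>alg_closure\<^esub> y"
  have "z \<noteq> \<zero>\<^bsub>alg_closure\<^esub>" using z(2) mn C.nat_pow_zero[of "lcm m n"] C.one_not_zero by auto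
  hence "s \<noteq> \<zero>\<^bsub>alg_closure\<^esub>" unfolding s_def using C.nat_pow_nonzero z(1) by simp
  hence s: "s \<in> indexed_const ` K - {\<zero>\<^bsub>alg_closure\<^esub>}" "s \<in> carrier alg_closure"
    unfolding s_def using pw[OF zK(2)] z(1) by auto
  have "s \<otimes>\<^bsub>alg_closure\<^esub> z = (z [^]\<^bsub>alg_closure\<^esub> u) [^]\<^bsub>alg_closure\<^esub> x"
    unfolding s_def using z(1) xy by (simp add: C.nat_pow_pow)
  hence sz: "s \<otimes>\<^bsub>alg_closure\<^esub> z \<in> indexed_const ` K" using pw[OF zK(1)] by simp
  note i = C.subfield_m_inv[OF K' s(1)]
  have "inv\<^bsub>alg_closure\<^esub> s \<in> carrier alg_closure" using i(1) subfieldE(3)[OF K'] by blast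
  hence "z = inv\<^bsub>alg_closure\<^esub> s \<otimes>\<^bsub>alg_closure\<^esub> (s \<otimes>\<^bsub>alg_closure\<^esub> z)"
    using i(3) z(1) s(2) by (simp add: C.m_assoc[symmetric])
  moreover have "inv\<^bsub>alg_closure\<^esub> s \<in> indexed_const ` K" using i(1) by blast
  ultimately show "z \<in> indexed_const ` K"
    using subringE(6)[OF subfieldE(1)[OF K'] _ sz] by metis
qed

text \<open>The algebraic closure has \<open>n\<close> distinct roots of unity, all in the image of
  \<open>K\<close> by hypothesis; the embedding is injective, so they can be counted in the field
  itself.\<close>

lemma (in field) contains_roots_of_unityD:
  assumes K: "subfield K R" and n: "n > 0" "[n] \<cdot> \<one> \<noteq> \<zero>" and roots: "contains_roots_of_unity K R n"
  shows "card {z \<in> carrier R. z [^] n = \<one>} = n" and "{z \<in> carrier R. z [^] n = \<one>} \<subseteq> K"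
proof -
  interpret C: algebraic_closure alg_closure "indexed_const ` carrier R" by (rule alg_closureE(1))
  interpret H: ring_hom_ring R alg_closure indexed_const
    using ring_axioms C.ring_axioms alg_closureE(2) by (rule ring_hom_ringI2)
  have inj: "inj indexed_const"
    by (rule injI) (metis indexed_const_def)
  have hp: "indexed_const (z [^] n) = indexed_const z [^]\<^bsub>alg_closure\<^esub> n" if "z \<in> carrier R" for z
    using H.hom_nat_pow that by simp
  have root_iff: "indexed_const z [^]\<^bsub>alg_closure\<^esub> n = \<one>\<^bsub>alg_closure\<^esub> \<longleftrightarrow> z [^] n = \<one>"
    if "z \<in> carrier R" for z
    using hp[OF that] H.hom_one inj by (metis injD)
  have hn: "indexed_const ([k] \<cdot> \<one>) = [k] \<cdot>\<^bsub>alg_closure\<^esub> \<one>\<^bsub>alg_closure\<^esub>" for k :: nat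
    by (induction k) simp_all
  have "[n] \<cdot>\<^bsub>alg_closure\<^esub> \<one>\<^bsub>alg_closure\<^esub> \<noteq> \<zero>\<^bsub>alg_closure\<^esub>"
    using hn[of n] H.hom_zero n(2) inj by (metis injD)
  hence "card {z \<in> carrier alg_closure. z [^]\<^bsub>alg_closure\<^esub> n = \<one>\<^bsub>alg_closure\<^esub>} = n"
    using C.card_roots_of_unity[OF n(1)]
      C.roots_over_carrier C.radical_poly(1)[OF monoid.one_closed[OF C.monoid_axioms]]
    by blast
  moreover have "{z \<in> carrier alg_closure. z [^]\<^bsub>alg_closure\<^esub> n = \<one>\<^bsub>alg_closure\<^esub>}
    = indexed_const ` {z \<in> carrier R. z [^] n = \<one>}"
  proof (intro equalityI subsetI)
    fix w assume w: "w \<in> {z \<in> carrier alg_closure. z [^]\<^bsub>alg_closure\<^esub> n = \<one>\<^bsub>alg_closure\<^esub>}"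
    then obtain z where "z \<in> K" "w = indexed_const z"
      using roots unfolding contains_roots_of_unity_def by blast
    thus "w \<in> indexed_const ` {z \<in> carrier R. z [^] n = \<one>}"
      using w root_iff[of z] subfieldE(3)[OF K] by auto
  qed (use root_iff in auto)
  ultimately show "card {z \<in> carrier R. z [^] n = \<one>} = n"
    by (metis card_image inj inj_on_subset subset_UNIV)
  show "{z \<in> carrier R. z [^] n = \<one>} \<subseteq> K"
  proof
    fix z assume "z \<in> {z \<in> carrier R. z [^] n = \<one>}"
    hence z: "z \<in> carrier R" "indexed_const z [^]\<^bsub>alg_closure\<^esub> n = \<one>\<^bsub>alg_closure\<^esub>"
      using root_iff by auto
    show "z \<in> K"
      using roots[unfolded contains_roots_of_unity_def, rule_format, OF H.hom_closed[OF z(1)] z(2)]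
      by (simp add: inj_image_mem_iff[OF inj])
  qed
qed

text \<open>If \<open>n\<close> times one vanished, the characteristic \<open>p\<close> would be
  positive, and a Bezout relation between \<open>n\<close> and \<open>p\<close> would make one
  vanish.\<close>

lemma (in field) coprime_ring_char_imp_nonzero:
  assumes "n > 0" "ring_char (R\<lparr>carrier := K\<rparr>) > 0 \<longrightarrow> gcd n (ring_char (R\<lparr>carrier := K\<rparr>)) = 1"
  shows "[n] \<cdot> \<one> \<noteq> \<zero>"
proof
  assume n0: "[n] \<cdot> \<one> = \<zero>"
  define p where "p = ring_char (R\<lparr>carrier := K\<rparr>)"
  \<comment> \<open>Restricting the carrier changes neither addition nor the unit, so the
    characteristic can be computed in the large field.\<close>
  have pw: "[k] \<cdot>\<^bsub>R\<lparr>carrier := K\<rparr>\<^esub> \<one>\<^bsub>R\<lparr>carrier := K\<rparr>\<^esub> = [k] \<cdot> \<one>" for k :: nat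
    by (simp add: add_pow_def nat_pow_def)
  have "\<exists>n::nat. n > 0 \<and> [n] \<cdot> \<one> = \<zero>" using n0 assms(1) by blast
  hence "p = (LEAST n::nat. n > 0 \<and> [n] \<cdot> \<one> = \<zero>)"
    unfolding p_def ring_char_def pw by simp
  hence p: "p > 0" "[p] \<cdot> \<one> = \<zero>"
    using LeastI[of "\<lambda>n::nat. n > 0 \<and> [n] \<cdot> \<one> = \<zero>" n] n0 assms(1) by auto
  obtain x y where xy: "n * x = p * y + 1"
    using bezout_nat[of n p] assms p(1) unfolding p_def by auto
  have "[(n * x)] \<cdot> \<one> = \<zero>" "[(p * y)] \<cdot> \<one> = \<zero>"
    using n0 p(2) add.nat_pow_pow[OF one_closed, of x n] add.nat_pow_pow[OF one_closed, of y p]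
    by (metis add.nat_pow_one)+
  thus False unfolding xy by simp
qed

text \<open>Rests on \<open>m n = gcd m n * lcm m n\<close>: a vanishing lcm would give zero
  divisors.\<close>

lemma (in domain) lcm_nonzero:
  fixes m n :: nat
  assumes "[m] \<cdot> \<one> \<noteq> \<zero>" "[n] \<cdot> \<one> \<noteq> \<zero>"
  shows "[lcm m n] \<cdot> \<one> \<noteq> \<zero>"
proof
  assume 0: "[lcm m n] \<cdot> \<one> = \<zero>"
  have "([m] \<cdot> \<one>) \<otimes> ([n] \<cdot> \<one>) = [(m * n)] \<cdot> \<one>"
    by (simp add: add_pow_ldistr add.nat_pow_pow mult.commute)
  also have "\<dots> = [gcd m n] \<cdot> ([lcm m n] \<cdot> \<one>)"
    by (simp add: add.nat_pow_pow mult.commute)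
  finally show False using 0 integral[of "[m] \<cdot> \<one>" "[n] \<cdot> \<one>"] assms by simp
qed

lemma (in field) common_exponent:
  assumes K: "subfield K R"
    and "\<And>a. a \<in> set xs \<Longrightarrow> d a > 0 \<and> [d a] \<cdot> \<one> \<noteq> \<zero> \<and> contains_roots_of_unity K R (d a)"
  shows "\<exists>N>0. [N] \<cdot> \<one> \<noteq> \<zero> \<and> contains_roots_of_unity K R N \<and> (\<forall>a\<in>set xs. d a dvd N)"
  using assms(2)
proof (induction xs)
  case Nil
  interpret C: algebraic_closure alg_closure "indexed_const ` carrier R" by (rule alg_closureE(1))
  \<comment> \<open>The exponent 1 serves the empty list, since the only first root of unity is
    one.\<close>
  have "indexed_const \<one> = \<one>\<^bsub>alg_closure\<^esub>" by (rule ring_hom_one[OF alg_closureE(2)])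
  hence "contains_roots_of_unity K R 1"
    unfolding contains_roots_of_unity_def using subringE(3)[OF subfieldE(1)[OF K]]
      by (auto intro: rev_image_eqI)
  thus ?case by (intro exI[of _ 1]) simp
next
  case (Cons a xs)
  then obtain N where N: "N > 0" "[N]
    \<cdot> \<one> \<noteq> \<zero>" "contains_roots_of_unity K R N" "\<forall>a\<in>set xs. d a dvd N"
    by auto
  have a: "d a > 0" "[d a] \<cdot> \<one> \<noteq> \<zero>" "contains_roots_of_unity K R (d a)"
    using Cons.prems[of a] by simp_all
  show ?case
  proof (intro exI[of _ "lcm (d a) N"] conjI)
    show "lcm (d a) N > 0" using a(1) N(1) by (rule lcm_pos_nat)
    show "[lcm (d a) N] \<cdot> \<one> \<noteq> \<zero>" by (rule lcm_nonzero[OF a(2) N(2)])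
    show "contains_roots_of_unity K R (lcm (d a) N)"
      by (rule contains_roots_of_unity_lcm[OF K a(1) N(1) a(3) N(3)])
    show "\<forall>b\<in>set (a # xs). d b dvd lcm (d a) N" using N(4) by (auto intro: dvd_lcmI2)
  qed
qed

subsection \<open>Homomorphisms of a simple radical extension\<close>

text \<open>Needed to apply minimality of \<open>Irr F a\<close>, which concerns polynomials over
  \<open>F\<close>, to a polynomial defined over the whole field.\<close>

lemma (in domain) radical_poly_in_subring:
  assumes "subring F R" "c \<in> F"
  shows "radical_poly n c \<in> carrier (F[X])"
proof -
  interpret P: domain "F[X]" using univ_poly_is_domain[OF assms(1)] .
  have C: "poly_of_const c \<in> carrier (F[X])"
    using assms by (simp add: poly_of_const_def univ_poly_def polynomial_def)
  have "radical_poly n c = X [^]\<^bsub>F[X]\<^esub> n \<ominus>\<^bsub>F[X]\<^esub> poly_of_const c"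
    unfolding radical_poly_def univ_poly_a_minus_consistent[OF assms(1) C]
    using unitary_monom_eq_var_pow[OF assms(1)] unitary_monom_eq_var_pow[OF carrier_is_subring]
      by simp
  thus ?thesis using var_closed(1)[OF assms(1)] C by simp
qed

text \<open>The substitution of \<open>s\<close> for \<open>a\<close> is well defined: if
  \<open>p\<close> and \<open>q\<close> agree at \<open>a\<close>, then \<open>Irr F a\<close>
  divides \<open>p - q\<close>, so they agree at its root \<open>s\<close> too.\<close>

lemma (in domain) simple_extension_hom:
  assumes "subfield F R" "a \<in> carrier R" "(algebraic over F) a"
    and "s \<in> carrier R" "eval (Irr F a) s = \<zero>"
  obtains \<tau> where "\<tau> \<in> ring_hom (R\<lparr>carrier := simple_extension F a\<rparr>) R"
    and "\<And>p. p \<in> carrier (F[X]) \<Longrightarrow> \<tau> (eval p a) = eval p s"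
proof -
  note F = subfieldE(1)[OF assms(1)]
  interpret P: domain "F[X]" using univ_poly_is_domain[OF F] .
  interpret A: ring_hom_cring "F[X]" R "\<lambda>p. eval p a" by (rule eval_cring_hom[OF F assms(2)])
  interpret S: ring_hom_cring "F[X]" R "\<lambda>p. eval p s" by (rule eval_cring_hom[OF F assms(4)])
  have E: "simple_extension F a = (\<lambda>p. eval p a) ` carrier (F[X])"
    by (rule simple_extension_as_eval_img[OF subfieldE(3)[OF assms(1)] assms(2)])
  have wd: "eval p s = eval q s"
    if pq: "p \<in> carrier (F[X])" "q \<in> carrier (F[X])" "eval p a = eval q a" for p q
  proof -
    have d: "p \<ominus>\<^bsub>F[X]\<^esub> q \<in> carrier (F[X])" using pq by simp
    have "eval (p \<ominus>\<^bsub>F[X]\<^esub> q) a = \<zero>"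
      using pq by (simp add: a_minus_def r_neg)
    hence "Irr F a pdivides (p \<ominus>\<^bsub>F[X]\<^esub> q)" using Irr_minimal[OF assms(1-3) d] by simp
    hence "eval (p \<ominus>\<^bsub>F[X]\<^esub> q) s = \<zero>"
      using pdivides_imp_root_sharing[OF carrier_polynomial_shell[OF F IrrE(1)[OF assms(1-3)]] _ assms(4) assms(5)]
        by simp
    hence "eval p s \<ominus> eval q s = \<zero>" using pq by (simp add: a_minus_def)
    thus ?thesis using pq S.hom_closed by simp
  qed
  \<comment> \<open>An arbitrary polynomial representing \<open>x\<close> is chosen; by
    \<open>wd\<close> the value at \<open>s\<close> does not depend on it.\<close>
  define \<tau> where "\<tau> x = eval (SOME p. p \<in> carrier (F[X]) \<and> eval p a = x) s" for x
  have \<tau>: "\<tau> (eval p a) = eval p s" if p: "p \<in> carrier (F[X])" for p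
  proof -
    have "(SOME q. q \<in> carrier (F[X]) \<and> eval q a = eval p a) \<in> carrier (F[X])
      \<and> eval (SOME q. q \<in> carrier (F[X]) \<and> eval q a = eval p a) a = eval p a"
      by (rule someI[of _ p]) (use p in simp)
    thus ?thesis unfolding \<tau>_def using wd p by blast
  qed
  have "\<tau> \<in> ring_hom (R\<lparr>carrier := simple_extension F a\<rparr>) R"
  proof (rule ring_hom_memI)
    fix x y assume "x \<in> carrier (R\<lparr>carrier := simple_extension F a\<rparr>)" "y \<in> carrier (R\<lparr>carrier := simple_extension F a\<rparr>)"
    then obtain p q where pq: "p \<in> carrier (F[X])" "x = eval p a" "q \<in> carrier (F[X])" "y = eval q a"
      unfolding E by auto
    show "\<tau> x \<in> carrier R" using \<tau> pq S.hom_closed by simp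
    show "\<tau> (x \<otimes>\<^bsub>R\<lparr>carrier := simple_extension F a\<rparr>\<^esub> y) = \<tau> x \<otimes> \<tau> y"
      using \<tau>[of "p \<otimes>\<^bsub>F[X]\<^esub> q"] \<tau> pq by simp
    show "\<tau> (x \<oplus>\<^bsub>R\<lparr>carrier := simple_extension F a\<rparr>\<^esub> y) = \<tau> x \<oplus> \<tau> y"
      using \<tau>[of "p \<oplus>\<^bsub>F[X]\<^esub> q"] \<tau> pq by simp
  next
    show "\<tau> \<one>\<^bsub>R\<lparr>carrier := simple_extension F a\<rparr>\<^esub> = \<one>"
      using \<tau>[OF P.one_closed] by simp
  qed
  thus thesis using that \<tau> by blast
qed

lemma (in field) radical_algebraic:
  fixes N :: nat
  assumes "subfield F R" "a \<in> carrier R" "N > 0" "a [^] N \<in> F"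
  shows "(algebraic over F) a"
proof -
  have "degree (radical_poly N (a [^] N)) = N"
    by (rule radical_poly(2)) (use assms in auto)
  moreover have "eval (radical_poly N (a [^] N)) a = \<zero>"
    using radical_poly(3)[of "a [^] N" a] assms(2) by simp
  ultimately show ?thesis
    using algebraicI[OF radical_poly_in_subring[OF subfieldE(1)[OF assms(1)] assms(4), of N]]
      assms(3) by fastforce
qed

text \<open>The cofactor of \<open>Irr F a\<close> in \<open>X^N - a^N\<close> has too few roots to account for all
  \<open>N\<close> roots \<open>z a\<close>.\<close>

lemma (in field) degree_Irr_le_card_roots:
  fixes N :: nat
  assumes F: "subfield F R" and a: "a \<in> carrier R" "a \<noteq> \<zero>" "N > 0" "a [^] N \<in> F"
    and mu: "card {z \<in> carrier R. z [^] N = \<one>} = N"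
  shows "degree (Irr F a) \<le> card {s \<in> carrier R. eval (Irr F a) s = \<zero>}"
proof -
  interpret P: domain "poly_ring R" using univ_poly_is_domain[OF carrier_is_subring] .
  note alg = radical_algebraic[OF F a(1,3,4)]
  let ?m = "Irr F a" and ?p = "radical_poly N (a [^] N)"
  have m: "?m \<in> carrier (poly_ring R)" "?m \<noteq> []"
    using carrier_polynomial_shell[OF subfieldE(1)[OF F] IrrE(1)[OF F a(1) alg]]
      pirreducible_degree[OF F IrrE(1,2)[OF F a(1) alg]] by auto
  have c: "a [^] N \<in> carrier R" using a by simp
  note p = radical_poly(1)[OF c] radical_poly(2)[OF c a(3)] radical_poly(3)[OF c]
  have "?m pdivides ?p"
    using Irr_minimal[OF F a(1) alg radical_poly_in_subring[OF subfieldE(1)[OF F] a(4)]] p(3)[OF a(1)]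
      c by simp
  then obtain q where q: "q \<in> carrier (poly_ring R)" "?p = ?m \<otimes>\<^bsub>poly_ring R\<^esub> q"
    by (auto simp: pdivides_def factor_def)
  have pne: "?p \<noteq> []" using p(2) a(3) by auto
  have qne: "q \<noteq> []" using q(2) pne m P.r_null by (auto simp: univ_poly_zero)
  have deg: "N = degree ?m + degree q"
    using poly_mult_degree_eq[OF carrier_is_subring, of ?m q] m q qne p(2)
    by (simp add: univ_poly_carrier univ_poly_mult)
  let ?Z = "(\<lambda>z. z \<otimes> a) ` {z \<in> carrier R. z [^] N = \<one>}"
  let ?S = "{s \<in> carrier R. eval ?m s = \<zero>}" and ?Q = "{s \<in> carrier R. eval q s = \<zero>}"
  \<comment> \<open>Since \<open>a\<close> is nonzero, the products \<open>z a\<close> are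
    \<open>N\<close> distinct roots of \<open>X^N - a^N\<close>.\<close>
  have "inj_on (\<lambda>z. z \<otimes> a) {z \<in> carrier R. z [^] N = \<one>}"
    by (rule inj_onI) (use a m_rcancel in auto)
  hence "N = card ?Z" using mu by (simp add: card_image)
  also have "?Z \<subseteq> ?S \<union> ?Q"
  proof
    fix s assume "s \<in> ?Z"
    then obtain z where z: "z \<in> carrier R" "z [^] N = \<one>" "s = z \<otimes> a" by auto
    hence s: "s \<in> carrier R" "s [^] N = a [^] N" using a by (auto simp: nat_pow_distrib)
    interpret E: ring_hom_cring "poly_ring R" R "\<lambda>p. eval p s"
      by (rule eval_cring_hom[OF carrier_is_subring s(1)])
    have "eval ?p s = \<zero>" using p(3)[OF s(1), of N] s c by simp
    hence "eval ?m s \<otimes> eval q s = \<zero>"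
      using E.hom_mult[OF m(1) q(1)] unfolding q(2) by simp
    thus "s \<in> ?S \<union> ?Q"
      using integral E.hom_closed[OF m(1)] E.hom_closed[OF q(1)] s(1) by auto
  qed
  hence "card ?Z \<le> card (?S \<union> ?Q)"
    using card_roots_le_degree(1)[OF m] card_roots_le_degree(1)[OF q(1) qne]
      by (intro card_mono) auto
  also have "\<dots> \<le> card ?S + card ?Q" by (rule card_Un_le)
  also have "\<dots> \<le> card ?S + degree q" using card_roots_le_degree(2)[OF q(1) qne, of ?Q] by simp
  finally show ?thesis using deg by simp
qed

text \<open>Write \<open>x = r(a)\<close> with \<open>r\<close> of degree below that of
  \<open>Irr F a\<close>. Sending \<open>a\<close> to any root \<open>s\<close> of
  \<open>Irr F a\<close> fixes \<open>x\<close>, so \<open>r(s) = x\<close>. Thus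
  \<open>r - x\<close> has more roots than its degree allows, and \<open>r\<close> is the constant
  \<open>x\<close>.\<close>

lemma (in field) fixed_by_all_homs:
  fixes N :: nat
  assumes F: "subfield F R" and a: "a \<in> carrier R" "a \<noteq> \<zero>" "N > 0" "a [^] N \<in> F"
    and mu: "card {z \<in> carrier R. z [^] N = \<one>} = N"
    and x: "x \<in> simple_extension F a"
    and fixed: "\<And>\<tau>. \<lbrakk>\<tau> \<in> ring_hom (R\<lparr>carrier := simple_extension F a\<rparr>) R; \<And>k. k \<in> F \<Longrightarrow> \<tau> k = k\<rbrakk> \<Longrightarrow> \<tau> x = x"
  shows "x \<in> F"
proof -
  note sF = subfieldE(1)[OF F]
  interpret U: domain "F[X]" using univ_poly_is_domain[OF sF] .
  interpret P: domain "poly_ring R" using univ_poly_is_domain[OF carrier_is_subring] .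
  note alg = radical_algebraic[OF F a(1,3,4)]
  let ?m = "Irr F a"
  note m = IrrE[OF F a(1) alg]
  have mne: "?m \<noteq> []" and mdeg: "degree ?m \<ge> 1"
    using pirreducible_degree[OF F m(1,2)] by auto
  obtain p where p: "p \<in> carrier (F[X])" "x = eval p a"
    using x simple_extension_as_eval_img[OF subfieldE(3)[OF F] a(1)] by auto
  define r where "r = p pmod ?m"
  have r: "r \<in> carrier (F[X])" "r = [] \<or> degree r < degree ?m"
    unfolding r_def using long_division_closed(2)[OF F p(1) m(1)] pmod_degree[OF F p(1) m(1) mne]
      by auto
  interpret A: ring_hom_cring "F[X]" R "\<lambda>p. eval p a" by (rule eval_cring_hom[OF sF a(1)])
  have "eval p a = eval ?m a \<otimes> eval (p pdiv ?m) a \<oplus> eval r a"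
    using arg_cong[OF pdiv_pmod[OF F p(1) m(1)], of "\<lambda>p. eval p a"]
      m(1) long_division_closed[OF F p(1) m(1)]
    unfolding r_def by simp
  hence xr: "x = eval r a"
    using p(2) m(4) A.hom_closed r(1) long_division_closed(1)[OF F p(1) m(1)] by simp
  have xR: "x \<in> carrier R" unfolding xr using A.hom_closed[OF r(1)] .
  note rR = carrier_polynomial_shell[OF sF r(1)]
  have rs: "eval r s = x" if s: "s \<in> carrier R" "eval ?m s = \<zero>" for s
  proof -
    obtain \<tau> where \<tau>: "\<tau> \<in> ring_hom (R\<lparr>carrier := simple_extension F a\<rparr>) R"
      "\<And>p. p \<in> carrier (F[X]) \<Longrightarrow> \<tau> (eval p a) = eval p s"
      using simple_extension_hom[OF F a(1) alg s] by blast
    have "\<tau> k = k" if k: "k \<in> F" for k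
    proof -
      have kR: "k \<in> carrier R" using k subfieldE(3)[OF F] by auto
      have "poly_of_const k \<in> carrier (F[X])"
        using k by (simp add: poly_of_const_def univ_poly_def polynomial_def)
      from \<tau>(2)[OF this] show ?thesis using eval_poly_of_const[OF kR] a(1) s(1) by simp
    qed
    hence "\<tau> x = x" using fixed \<tau>(1) by blast
    thus ?thesis using \<tau>(2)[OF r(1)] xr by simp
  qed
  \<comment> \<open>The difference is formed over the whole field because \<open>x\<close> is not
    yet known to lie in \<open>F\<close>.\<close>
  define t where "t = r \<ominus>\<^bsub>poly_ring R\<^esub> poly_of_const x"
  note C = poly_of_const_closed[OF xR]
  have t: "t \<in> carrier (poly_ring R)" unfolding t_def using rR C by simp
  have ts: "eval t s = \<zero>" if s: "s \<in> carrier R" "eval ?m s = \<zero>" for s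
  proof -
    interpret E: ring_hom_cring "poly_ring R" R "\<lambda>p. eval p s"
      by (rule eval_cring_hom[OF carrier_is_subring s(1)])
    show ?thesis unfolding t_def a_minus_def using rR C rs[OF s] eval_poly_of_const[OF xR s(1)] xR
      by (simp add: r_neg)
  qed
  have "degree t \<le> max (degree r) (degree (\<ominus>\<^bsub>poly_ring R\<^esub> poly_of_const x))"
    unfolding t_def a_minus_def univ_poly_add by (rule poly_add_degree)
  also have "degree (\<ominus>\<^bsub>poly_ring R\<^esub> poly_of_const x) = 0"
    unfolding univ_poly_a_inv_degree[OF carrier_is_subring C] by (simp add: poly_of_const_def)
  \<comment> \<open>The empty list has degree 0, so \<open>mdeg\<close> settles the case
    \<open>r = []\<close>.\<close>
  finally have tdeg: "degree t < degree ?m" using r(2) mdeg by auto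
  have "t = []"
  proof (rule ccontr)
    assume "t \<noteq> []"
    hence "card {s \<in> carrier R. eval ?m s = \<zero>} \<le> degree t"
      using ts by (intro card_roots_le_degree(2)[OF t]) auto
    thus False using degree_Irr_le_card_roots[OF F a mu] tdeg by simp
  qed
  hence "r = poly_of_const x"
    using t_def rR C P.r_right_minus_eq by (simp add: univ_poly_zero)
  \<comment> \<open>The coefficients of \<open>r\<close> lie in \<open>F\<close>. For
    \<open>x\<close> zero the list is empty, and \<open>x\<close> is in \<open>F\<close> as its
    zero.\<close>
  hence "set (poly_of_const x) \<subseteq> F" using r(1) by (auto simp: univ_poly_def polynomial_def)
  thus "x \<in> F" using subringE(2)[OF sF] by (auto simp: poly_of_const_def split: if_splits)
qed

subsection \<open>Independence in radical extensions\<close>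

text \<open>Additivity of \<open>\<tau>\<close> is available only on \<open>E\<close>, so the
  induction also carries membership of the partial sums in \<open>E\<close>.\<close>

lemma (in ring) ring_hom_finsum_on_subring:
  assumes "subring E R" "\<tau> \<in> ring_hom (R\<lparr>carrier := E\<rparr>) R" "finite I" "f \<in> I \<rightarrow> E"
  shows "finsum R f I \<in> E \<and> \<tau> (finsum R f I) = (\<Oplus>i\<in>I. \<tau> (f i))"
  using assms(3,4)
proof (induction I rule: finite_induct)
  case empty
  interpret T: ring_hom_ring "R\<lparr>carrier := E\<rparr>" R \<tau>
    using subring_is_ring[OF assms(1)] ring_axioms assms(2) by (intro ring_hom_ringI2)
  show ?case using T.hom_zero subringE(2)[OF assms(1)] by simp
next
  case (insert i I)
  have E: "E \<subseteq> carrier R" by (rule subringE(1)[OF assms(1)])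
  have f: "f i \<in> E" "f \<in> I \<rightarrow> E" "finsum R f I \<in> E" using insert by auto
  hence f': "f i \<in> carrier R" "f \<in> I \<rightarrow> carrier R" using E by auto
  have \<tau>: "\<tau> e \<in> carrier R" if "e \<in> E" for e using ring_hom_closed[OF assms(2)] that by simp
  have "\<tau> (f i \<oplus> finsum R f I) = \<tau> (f i) \<oplus> \<tau> (finsum R f I)"
    using ring_hom_add[OF assms(2)] f by simp
  thus ?case using insert f f' \<tau> subringE(7)[OF assms(1)] by (simp add: Pi_def)
qed

text \<open>Families are indexed so that a relation can be divided by one of its members without
  reindexing.\<close>

definition (in ring) kummer_independent :: "'a set \<Rightarrow> nat \<Rightarrow> 'a set \<Rightarrow> bool" where
  "kummer_independent K N F \<longleftrightarrow>
    (\<forall>(I :: nat set) c x. finite I \<longrightarrow> c \<in> I \<rightarrow> K \<longrightarrow> x \<in> I \<rightarrow> F \<longrightarrow>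
      (\<forall>i\<in>I. x i \<noteq> \<zero> \<and> x i [^] N \<in> K) \<longrightarrow>
      (\<forall>i\<in>I. \<forall>j\<in>I. i \<noteq> j \<longrightarrow> (\<forall>k\<in>K. x i \<noteq> k \<otimes> x j)) \<longrightarrow>
      (\<Oplus>i\<in>I. c i \<otimes> x i) = \<zero> \<longrightarrow> (\<forall>i\<in>I. c i = \<zero>))"

text \<open>Any two nonzero elements of \<open>K\<close> are proportional over \<open>K\<close>, so
  the index set has at most one element.\<close>

lemma (in field) kummer_independent_base:
  assumes "subfield K R"
  shows "kummer_independent K N K"
  unfolding kummer_independent_def
proof (intro allI impI ballI)
  fix I :: "nat set" and c x i
  assume I: "finite I" "c \<in> I \<rightarrow> K" "x \<in> I \<rightarrow> K" "\<forall>i\<in>I. x i \<noteq> \<zero> \<and> x i [^] N \<in> K"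
    "\<forall>i\<in>I. \<forall>j\<in>I. i \<noteq> j \<longrightarrow> (\<forall>k\<in>K. x i \<noteq> k \<otimes> x j)" "(\<Oplus>i\<in>I. c i \<otimes> x i) = \<zero>" "i \<in> I"
  have KR: "K \<subseteq> carrier R" by (rule subfieldE(3)[OF assms])
  have "j = i" if "j \<in> I" for j
  proof (rule ccontr)
    assume "j \<noteq> i"
    have x: "x i \<in> K - {\<zero>}" "x j \<in> K" using I that by auto
    have "x j = (x j \<otimes> inv (x i)) \<otimes> x i"
      using x KR subfield_m_inv[OF assms x(1)] by (simp add: m_assoc subset_iff)
    moreover have "x j \<otimes> inv (x i) \<in> K"
      using x subfield_m_inv[OF assms x(1)] subringE(6)[OF subfieldE(1)[OF assms]] by auto
    ultimately show False using I(5,7) that \<open>j \<noteq> i\<close> by blast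
  qed
  hence Ii: "I = {i}" using I(7) by blast
  have ci: "c i \<in> carrier R" "x i \<in> carrier R" "x i \<noteq> \<zero>"
    using Pi_mem[OF I(2,7)] Pi_mem[OF I(3,7)] I(4,7) KR by blast+
  moreover have "c i \<otimes> x i = \<zero>" using I(6) ci(1,2) unfolding Ii by simp
  ultimately show "c i = \<zero>" using integral by blast
qed

text \<open>Minimality of a relation is replaced by induction over proper subsets of the index set,
  with the family \<open>x\<close> fixed and the coefficients varying.\<close>

lemma (in field) kummer_independent_step:
  assumes K: "subfield K R" and F: "subfield F R" and KF: "K \<subseteq> F"
    and a: "a \<in> carrier R" "a \<noteq> \<zero>" "N > 0" "a [^] N \<in> K"
    and mu: "card {z \<in> carrier R. z [^] N = \<one>} = N" "{z \<in> carrier R. z [^] N = \<one>} \<subseteq> K"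
    and indep: "kummer_independent K N F"
  shows "kummer_independent K N (simple_extension F a)"
  unfolding kummer_independent_def
proof (intro allI impI)
  define E where "E = simple_extension F a"
  note KR = subfieldE(3)[OF K] and sK = subfieldE(1)[OF K]
  have aF: "a [^] N \<in> F" using a KF by auto
  have FE: "F \<subseteq> E" unfolding E_def by (rule simple_extension_incl[OF subfieldE(3)[OF F] a(1)])
  have "subfield E R" unfolding E_def
    using simple_extension_is_subfield[OF F a(1)] radical_algebraic[OF F a(1,3) aF] by simp
  note E = this subfieldE(1)[OF this] subfieldE(3)[OF this]
  fix I :: "nat set" and c x
  assume "finite I" "c \<in> I \<rightarrow> K" "x \<in> I \<rightarrow> simple_extension F a" "\<forall>i\<in>I. x i \<noteq> \<zero> \<and> x i [^] N \<in> K"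
    "\<forall>i\<in>I. \<forall>j\<in>I. i \<noteq> j \<longrightarrow> (\<forall>k\<in>K. x i \<noteq> k \<otimes> x j)" "(\<Oplus>i\<in>I. c i \<otimes> x i) = \<zero>"
  thus "\<forall>i\<in>I. c i = \<zero>" unfolding E_def[symmetric]
  proof (induction I arbitrary: c rule: finite_psubset_induct)
    case (psubset I)
    note c = psubset.prems(1) and x = psubset.prems(2,3) and np = psubset.prems(4) and sum = psubset.prems(5)
    have cK: "c i \<in> K" "c i \<in> carrier R" "c i \<in> E" if "i \<in> I" for i using c that KR KF FE by auto
    have xE: "x i \<in> E" "x i \<in> carrier R" "x i \<noteq> \<zero>" "x i [^] N \<in> K" if "i \<in> I" for i
      using x that E(3) by (auto simp: Pi_iff subset_iff)
    show ?case
    proof (rule ccontr)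
      assume "\<not> (\<forall>i\<in>I. c i = \<zero>)"
      then obtain i0 where i0: "i0 \<in> I" "c i0 \<noteq> \<zero>" by auto
      have inv0: "inv (x i0) \<in> E" "inv (x i0) \<in> carrier R" "inv (x i0) \<otimes> x i0 = \<one>" "x i0 \<otimes> inv (x i0) = \<one>"
        "inv (x i0) \<noteq> \<zero>"
        using subfield_m_inv[OF E(1), of "x i0"] xE[OF i0(1)] E(3) by auto
      \<comment> \<open>The ratios to one member \<open>x i0\<close> with nonzero coefficient; the
        aim is a relation among those that lie in \<open>F\<close>.\<close>
      define y where "y i = x i \<otimes> inv (x i0)" for i
      have yE: "y i \<in> E" "y i \<in> carrier R" "y i \<otimes> x i0 = x i" if "i \<in> I" for i
        unfolding y_def using xE[OF that] xE[OF i0(1)] inv0 subringE(6)[OF E(2)] E(3)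
        by (auto simp: m_assoc)
      have yF: "y i \<in> F" if i: "i \<in> I" "c i \<noteq> \<zero>" for i
      proof (rule fixed_by_all_homs[OF F a(1-3) aF mu(1) yE(1)[OF i(1), unfolded E_def]], fold E_def)
        fix \<tau> assume \<tau>: "\<tau> \<in> ring_hom (R\<lparr>carrier := E\<rparr>) R" "\<And>k. k \<in> F \<Longrightarrow> \<tau> k = k"
        interpret T: ring_hom_ring "R\<lparr>carrier := E\<rparr>" R \<tau>
          using subring_is_ring[OF E(2)] ring_axioms \<tau>(1) by (intro ring_hom_ringI2)
        have \<tau>c: "\<tau> e \<in> carrier R" if "e \<in> E" for e using T.hom_closed that by simp
        have \<tau>m: "\<tau> (e \<otimes> f) = \<tau> e \<otimes> \<tau> f" if "e \<in> E" "f \<in> E" for e f using T.hom_mult that by simp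
        have \<tau>p: "\<tau> (e [^] N) = \<tau> e [^] N" if "e \<in> E" for e
          using T.hom_nat_pow[of e N] that by (simp add: nat_pow_consistent[symmetric])
        \<comment> \<open>The factor is \<open>\<tau> (x j) / x j\<close>. Its \<open>N\<close>-th
          power is one, because \<open>\<tau>\<close> fixes \<open>x j [^] N\<close>, so it lies in
          \<open>K\<close> by \<open>mu(2)\<close>.\<close>
        have "\<exists>w. w \<in> K \<and> w \<noteq> \<zero> \<and> \<tau> (x j) = w \<otimes> x j" if j: "j \<in> I" for j
        proof -
          note xj = xE[OF j]
          have iv: "inv (x j) \<in> carrier R" "inv (x j) \<otimes> x j = \<one>"
            using subfield_m_inv[OF E(1), of "x j"] xj E(3) by auto
          define w where "w = \<tau> (x j) \<otimes> inv (x j)"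
          have w: "w \<in> carrier R" "\<tau> (x j) = w \<otimes> x j"
            unfolding w_def using \<tau>c[OF xj(1)] xj iv by (auto simp: m_assoc)
          have "w [^] N \<otimes> x j [^] N = \<tau> (x j) [^] N" using w xj by (simp add: nat_pow_distrib)
          also have "\<dots> = x j [^] N" using \<tau>p[OF xj(1)] \<tau>(2) xj(4) KF by auto
          also have "\<dots> = \<one> \<otimes> x j [^] N" using xj by simp
          finally have "w [^] N = \<one>"
            using m_rcancel[of "x j [^] N" "w [^] N" \<one>] xj w(1) nat_pow_nonzero by simp
          moreover from this have "w \<noteq> \<zero>"
            using a(3) by (metis nat_pow_zero not_gr_zero one_not_zero)
          ultimately show ?thesis using mu(2) w by blast
        qed
        then obtain w where w: "\<And>j. j \<in> I \<Longrightarrow> w j \<in> K" "\<And>j. j \<in> I \<Longrightarrow> w j \<noteq> \<zero>"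
          "\<And>j. j \<in> I \<Longrightarrow> \<tau> (x j) = w j \<otimes> x j" by metis
        have wR: "w j \<in> carrier R" if "j \<in> I" for j using w(1) that KR by auto
        \<comment> \<open>The coefficients of the image of the relation under \<open>\<tau>\<close>
          minus \<open>w i0\<close> times the relation. The one at \<open>i0\<close> vanishes, so
          the induction hypothesis applies to \<open>I - {i0}\<close>.\<close>
        define d where "d j = c j \<otimes> (w j \<ominus> w i0)" for j
        have d: "d j \<in> K" "d j \<in> carrier R" if "j \<in> I" for j
        proof -
          show "d j \<in> K" unfolding d_def a_minus_def
            using cK(1)[OF that] w(1)[OF that] w(1)[OF i0(1)] subringE(5,6,7)[OF sK] by simp
          thus "d j \<in> carrier R" using KR by auto
        qed
        have "\<tau> (\<Oplus>j\<in>I. c j \<otimes> x j) = (\<Oplus>j\<in>I. \<tau> (c j \<otimes> x j))"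
          using ring_hom_finsum_on_subring[OF E(2) \<tau>(1) psubset.hyps(1), of "\<lambda>j. c j \<otimes> x j"]
            cK(3) xE(1) subringE(6)[OF E(2)] by auto
        also have "\<dots> = (\<Oplus>j\<in>I. d j \<otimes> x j \<oplus> w i0 \<otimes> (c j \<otimes> x j))"
        proof (rule finsum_cong')
          fix j assume j: "j \<in> I"
          have "\<tau> (c j) = c j" using \<tau>(2) cK(1)[OF j] KF by auto
          hence "\<tau> (c j \<otimes> x j) = c j \<otimes> (w j \<otimes> x j)"
            using \<tau>m cK(3)[OF j] xE(1)[OF j] w(3)[OF j] by simp
          also have "\<dots> = d j \<otimes> x j \<oplus> w i0 \<otimes> (c j \<otimes> x j)"
            unfolding d_def using cK(2)[OF j] xE(2)[OF j] wR[OF j] wR[OF i0(1)] by algebra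
          finally show "\<tau> (c j \<otimes> x j) = d j \<otimes> x j \<oplus> w i0 \<otimes> (c j \<otimes> x j)" .
        qed (use d xE cK wR i0 in auto)
        also have "\<dots> = (\<Oplus>j\<in>I. d j \<otimes> x j) \<oplus> w i0 \<otimes> (\<Oplus>j\<in>I. c j \<otimes> x j)"
          using d(2) xE(2) cK(2) wR[OF i0(1)] psubset.hyps(1)
          by (subst finsum_addf) (auto simp: finsum_rdistr Pi_def)
        finally have "(\<Oplus>j\<in>I. d j \<otimes> x j) = \<zero>"
          using sum T.hom_zero wR[OF i0(1)] d(2) xE(2) by (simp add: Pi_def)
        moreover have "(\<Oplus>j\<in>I. d j \<otimes> x j) = d i0 \<otimes> x i0 \<oplus> (\<Oplus>j\<in>I - {i0}. d j \<otimes> x j)"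
          using finsum_insert[of "I - {i0}" i0 "\<lambda>j. d j \<otimes> x j"] psubset.hyps(1) i0(1) d(2) xE(2)
          by (simp add: Pi_def insert_absorb)
        moreover have "d i0 = \<zero>"
          unfolding d_def using wR[OF i0(1)] cK(2)[OF i0(1)] by (simp add: r_neg a_minus_def)
        ultimately have "(\<Oplus>j\<in>I - {i0}. d j \<otimes> x j) = \<zero>"
          using xE(2) d(2) i0(1) by (simp add: Pi_def)
        hence "\<forall>j\<in>I - {i0}. d j = \<zero>"
          using psubset.prems d(1) i0(1) by (intro psubset.IH) auto
        hence "d i = \<zero>" using \<open>d i0 = \<zero>\<close> i(1) by auto
        hence "w i \<ominus> w i0 = \<zero>"
          unfolding d_def using integral[of "c i" "w i \<ominus> w i0"] cK(2)[OF i(1)]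
            i(2) wR i(1) i0(1) by auto
        hence ww: "w i = w i0" using wR i(1) i0(1) by simp
        \<comment> \<open>Multiplying by \<open>\<tau> (x i0) = w i0 \<otimes> x i0\<close> avoids
          computing \<open>\<tau>\<close> of an inverse; this nonzero factor is cancelled at the
          end.\<close>
        have "\<tau> (y i) \<otimes> (w i0 \<otimes> x i0) = \<tau> (x i)"
          using \<tau>m[OF yE(1)[OF i(1)] xE(1)[OF i0(1)]] yE(3)[OF i(1)] w(3)[OF i0(1)] by simp
        also have "\<dots> = w i0 \<otimes> (y i \<otimes> x i0)" using w(3)[OF i(1)] ww yE(3)[OF i(1)] by simp
        also have "\<dots> = y i \<otimes> (w i0 \<otimes> x i0)"
          using yE(2)[OF i(1)] wR[OF i0(1)] xE(2)[OF i0(1)] by (simp add: m_lcomm)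
        finally show "\<tau> (y i) = y i"
          using m_rcancel[of "w i0 \<otimes> x i0" "\<tau> (y i)" "y i"] \<tau>c[OF yE(1)[OF i(1)]] yE(2)[OF i(1)]
            wR[OF i0(1)] xE[OF i0(1)] w(2)[OF i0(1)] integral[of "w i0" "x i0"] by auto
      qed
      \<comment> \<open>Membership of \<open>y i\<close> in \<open>F\<close> is known only where
        \<open>c i\<close> is nonzero, so the other terms are dropped before dividing by
        \<open>x i0\<close>.\<close>
      define J where "J = {i \<in> I. c i \<noteq> \<zero>}"
      have J: "finite J" "J \<subseteq> I" unfolding J_def using psubset.hyps(1) by auto
      have JI: "i \<in> I" if "i \<in> J" for i using that J by auto
      have "(\<Oplus>i\<in>J. c i \<otimes> x i) = (\<Oplus>i\<in>I. c i \<otimes> x i)"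
        using cK(2) xE(2) psubset.hyps(1)
        by (intro add.finprod_mono_neutral_cong_left) (auto simp: J_def)
      hence sJ: "(\<Oplus>i\<in>J. c i \<otimes> x i) = \<zero>" using sum by simp
      have "(\<Oplus>i\<in>J. c i \<otimes> y i) = (\<Oplus>i\<in>J. (c i \<otimes> x i) \<otimes> inv (x i0))"
        using cK(2) xE(2) inv0(2) JI by (intro finsum_cong') (auto simp: y_def m_assoc)
      also have "\<dots> = (\<Oplus>i\<in>J. c i \<otimes> x i) \<otimes> inv (x i0)"
        using cK(2) xE(2) inv0(2) J(1) JI by (intro finsum_ldistr[symmetric]) auto
      finally have s0: "(\<Oplus>i\<in>J. c i \<otimes> y i) = \<zero>" using sJ inv0(2) by simp
      have ynz: "y i \<noteq> \<zero> \<and> y i [^] N \<in> K" if "i \<in> J" for i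
      proof
        note i = JI[OF that]
        show "y i \<noteq> \<zero>" using yE(3)[OF i] xE(2,3)[OF i] xE(2)[OF i0(1)] by auto
        have x0: "x i0 [^] N \<in> K - {\<zero>}" using xE[OF i0(1)] nat_pow_nonzero by auto
        note inv = subfield_m_inv[OF K x0]
        have "y i [^] N \<otimes> x i0 [^] N = x i [^] N"
          using nat_pow_distrib[OF yE(2)[OF i] xE(2)[OF i0(1)], of N] yE(3)[OF i] by simp
        hence "x i [^] N \<otimes> inv (x i0 [^] N) = y i [^] N \<otimes> (x i0 [^] N \<otimes> inv (x i0 [^] N))"
          using yE(2)[OF i] xE(2)[OF i0(1)] inv(1) KR by (simp add: m_assoc[symmetric] subset_iff)
        hence "y i [^] N = x i [^] N \<otimes> inv (x i0 [^] N)" using inv(2) yE(2)[OF i] by simp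
        thus "y i [^] N \<in> K"
          using subringE(6)[OF sK xE(4)[OF i]] inv(1) by simp
      qed
      have ynp: "y i \<noteq> k \<otimes> y j" if "i \<in> J" "j \<in> J" "i \<noteq> j" "k \<in> K" for i j k
      proof
        assume "y i = k \<otimes> y j"
        hence "y i \<otimes> x i0 = k \<otimes> (y j \<otimes> x i0)"
          using yE(2)[OF JI[OF that(2)]] xE(2)[OF i0(1)]
            that(4) KR by (simp add: m_assoc subset_iff)
        hence "x i = k \<otimes> x j" using yE(3) JI that by simp
        thus False using np JI that by blast
      qed
      have yFJ: "y \<in> J \<rightarrow> F" and cJ: "c \<in> J \<rightarrow> K" using yF cK(1) by (auto simp: J_def)
      have "c i0 = \<zero>"
        \<comment> \<open>The divided relation lives in \<open>F\<close> and keeps the coefficients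
          \<open>c\<close>, so goodness of \<open>F\<close> kills even \<open>c i0\<close>.\<close>
        using indep[unfolded kummer_independent_def, rule_format, OF J(1) cJ yFJ ynz ynp s0, of i0]
          i0
        unfolding J_def by blast
      thus False using i0 by simp
    qed
  qed
qed

text \<open>The elements are adjoined one at a time; the \<open>N\<close>-th power of each lies in
  \<open>K\<close>, hence in the field reached so far.\<close>

lemma (in field) kummer_independent_finite_extension:
  assumes K: "subfield K R" and N: "N > 0"
    and mu: "card {z \<in> carrier R. z [^] N = \<one>} = N" "{z \<in> carrier R. z [^] N = \<one>} \<subseteq> K"
    and as: "\<And>a. a \<in> set as \<Longrightarrow> a \<in> carrier R \<and> a \<noteq> \<zero> \<and> a [^] N \<in> K"
  shows "subfield (finite_extension K as) R \<and> K \<subseteq> finite_extension K as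
    \<and> kummer_independent K N (finite_extension K as)"
  using as
proof (induction as)
  case Nil
  show ?case using K kummer_independent_base[OF K] by simp
next
  case (Cons a as)
  let ?F = "finite_extension K as"
  have IH: "subfield ?F R" "K \<subseteq> ?F" "kummer_independent K N ?F" using Cons by auto
  have a: "a \<in> carrier R" "a \<noteq> \<zero>" "a [^] N \<in> K" using Cons.prems by auto
  have "subfield (simple_extension ?F a) R"
    using simple_extension_is_subfield[OF IH(1) a(1)] radical_algebraic[OF IH(1) a(1) N]
      a(3) IH(2) by auto
  moreover have "?F \<subseteq> simple_extension ?F a"
    by (rule simple_extension_incl[OF subfieldE(3)[OF IH(1)] a(1)])
  ultimately show ?case
    using kummer_independent_step[OF K IH(1,2) a(1,2) N a(3) mu IH(3)] IH(2) by simp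
qed

section \<open>From list combinations to indexed families, and the conclusion\<close>

lemma (in ring) combine_eq_finsum:
  assumes "length Ks = length Us" "set Ks \<subseteq> carrier R" "set Us \<subseteq> carrier R"
  shows "combine Ks Us = (\<Oplus>i\<in>{..<length Us}. Ks ! i \<otimes> Us ! i)"
  using assms
proof (induction Ks Us rule: list_induct2)
  case Nil
  show ?case by simp
next
  case (Cons k Ks u Us)
  have c: "Ks ! i \<in> carrier R" "Us ! i \<in> carrier R" if "i < length Us" for i
    using Cons that nth_mem by (metis insert_subset list.set(2) subsetD)+
  let ?f = "\<lambda>i. (k # Ks) ! i \<otimes> (u # Us) ! i"
  have "finsum R ?f (insert 0 (Suc ` {..<length Us})) = k \<otimes> u \<oplus> finsum R ?f (Suc ` {..<length Us})"
    using Cons.prems c by (subst finsum_insert) auto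
  also have "finsum R ?f (Suc ` {..<length Us}) = (\<Oplus>i\<in>{..<length Us}. Ks ! i \<otimes> Us ! i)"
    using c by (subst finsum_reindex) auto
  finally show ?case using Cons by (simp add: lessThan_Suc_eq_insert_0)
qed

text \<open>A proportionality would put \<open>a\<close> in the span of \<open>b\<close>; the factor
  zero gives that \<open>a\<close> is nonzero.\<close>

lemma (in field) independent_pair:
  assumes K: "subfield K R" and "independent K [a, b]"
  shows "a \<noteq> \<zero>" and "k \<in> K \<Longrightarrow> a \<noteq> k \<otimes> b"
proof -
  have c: "a \<in> carrier R" "b \<in> carrier R" using independent_in_carrier[OF assms(2)] by auto
  note sK = subfieldE(1)[OF K]
  have *: "a \<notin> Span K [b]" by (rule independent_backwards(1)[OF assms(2)])
  show 1: "a \<noteq> k \<otimes> b" if "k \<in> K" for k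
  proof
    assume "a = k \<otimes> b"
    hence "a = combine [k] [b]" using c that subfieldE(3)[OF K] by auto
    hence "a \<in> {combine Ks [b] | Ks. set Ks \<subseteq> K}"
      using that by (intro CollectI exI[of _ "[k]"]) simp
    thus False using * Span_eq_combine_set[OF K, of "[b]"] c by simp
  qed
  show "a \<noteq> \<zero>" using 1[of \<zero>] subringE(2)[OF sK] c by auto
qed

lemma (in monoid) nat_pow_dvd_closed:
  assumes "submonoid K G" "a \<in> carrier G" "a [^] (m::nat) \<in> K" "m dvd n"
  shows "a [^] n \<in> K"
proof -
  obtain k where k: "n = m * k" using assms(4) by auto
  have "(a [^] m) [^] j \<in> K" for j :: nat
    by (induction j) (use assms submonoid.m_closed submonoid.one_closed in auto)
  thus ?thesis unfolding k using assms(2) by (simp add: nat_pow_pow[symmetric])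
qed

theorem theorem3:
  fixes L :: "('a, 'b) ring_scheme" and K A :: "'a set"
  assumes "field L" and "subfield K L"
    and "A \<in> theta K L"
    and "\<And>a. a \<in> A \<Longrightarrow> contains_roots_of_unity K L (root_degree K L a)"
  shows "lin_independent_set K L A"
  unfolding lin_independent_set_def
proof (intro allI impI, elim conjE)
  interpret field L by fact
  note K = \<open>subfield K L\<close>
  let ?d = "root_degree K L"
  have AL: "A \<subseteq> carrier L" and A2: "infinite A \<or> card A \<ge> 2"
    and Ad: "\<And>a. a \<in> A \<Longrightarrow> \<exists>n::nat. n \<ge> 1 \<and> a [^]\<^bsub>L\<^esub> n \<in> K"
    and Ai: "\<And>a b. a \<in> A \<Longrightarrow> b \<in> A \<Longrightarrow> a \<noteq> b \<Longrightarrow> independent K [a, b]"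
    and Ac: "\<And>a. a \<in> A \<Longrightarrow> ring_char (L\<lparr>carrier := K\<rparr>) > 0 \<longrightarrow> gcd (?d a) (ring_char (L\<lparr>carrier := K\<rparr>)) = 1"
    using assms(3) unfolding theta_def by auto
  have nz: "a \<noteq> \<zero>\<^bsub>L\<^esub>" if a: "a \<in> A" for a
  proof -
    \<comment> \<open>The cardinality condition supplies a partner \<open>b\<close>, and pairwise
      independence then excludes zero.\<close>
    have "\<not> A \<subseteq> {a}"
      using A2 card_mono[of "{a}" A] finite_subset[of A "{a}"] by auto
    then obtain b where "b \<in> A" "a \<noteq> b" by auto
    thus ?thesis using independent_pair(1)[OF K Ai[OF a]] by blast
  qed
  have d: "?d a > 0" "a [^]\<^bsub>L\<^esub> ?d a \<in> K" if "a \<in> A" for a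
    using LeastI_ex[OF Ad[OF that]] unfolding root_degree_def by auto
  fix xs assume xs: "distinct xs" "set xs \<subseteq> A"
  have "\<exists>N>0. [N] \<cdot>\<^bsub>L\<^esub> \<one>\<^bsub>L\<^esub> \<noteq> \<zero>\<^bsub>L\<^esub> \<and> contains_roots_of_unity K L N \<and> (\<forall>a\<in>set xs. ?d a dvd N)"
  proof (rule common_exponent[OF K])
    fix a assume "a \<in> set xs"
    hence a: "a \<in> A" using xs by auto
    show "?d a > 0 \<and> [?d a] \<cdot>\<^bsub>L\<^esub> \<one>\<^bsub>L\<^esub> \<noteq> \<zero>\<^bsub>L\<^esub> \<and> contains_roots_of_unity K L (?d a)"
      using d(1)[OF a] coprime_ring_char_imp_nonzero[OF d(1)[OF a] Ac[OF a]] assms(4)[OF a] by simp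
  qed
  then obtain N where N: "N > 0" "[N] \<cdot>\<^bsub>L\<^esub> \<one>\<^bsub>L\<^esub> \<noteq> \<zero>\<^bsub>L\<^esub>" "contains_roots_of_unity K L N"
    "\<And>a. a \<in> set xs \<Longrightarrow> ?d a dvd N" by blast
  have xsL: "set xs \<subseteq> carrier L" using xs AL by auto
  have xsN: "a \<in> carrier L \<and> a \<noteq> \<zero>\<^bsub>L\<^esub> \<and> a [^]\<^bsub>L\<^esub> N \<in> K" if "a \<in> set xs" for a
    using nat_pow_dvd_closed[OF subring.axioms(2)[OF subfieldE(1)[OF K]], of a] d(2)[of a]
      N(4)[OF that]
      nz[of a] xs xsL that by blast
  have ind: "kummer_independent K N (finite_extension K xs)"
    using kummer_independent_finite_extension[OF K N(1) contains_roots_of_unityD[OF K N(1-3)] xsN]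
      by blast
  show "independent K xs"
  proof (rule ccontr)
    assume "\<not> independent K xs"
    then obtain Ks where Ks: "length Ks = length xs" "combine Ks xs = \<zero>\<^bsub>L\<^esub>" "set Ks \<subseteq> K" "set Ks \<noteq> {\<zero>\<^bsub>L\<^esub>}"
      using dependent_imp_non_trivial_combine[OF K xsL] by blast
    have "Ks ! i = \<zero>\<^bsub>L\<^esub>" if i: "i \<in> {..<length xs}" for i
    \<comment> \<open>The family is indexed by the positions in \<open>xs\<close>; distinctness of
      \<open>xs\<close> turns different positions into different elements of \<open>A\<close>, which
      are not proportional.\<close>
    proof (rule ind[unfolded kummer_independent_def, rule_format, of "{..<length xs}" "(!) Ks" "(!) xs"])
      show "(!) Ks \<in> {..<length xs} \<rightarrow> K" using Ks(1,3) by (auto simp: subset_iff)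
      show "(!) xs \<in> {..<length xs} \<rightarrow> finite_extension K xs"
        using finite_extension_mem[OF subfieldE(1)[OF K] xsL] by (auto simp: subset_iff)
      show "(\<Oplus>\<^bsub>L\<^esub>i\<in>{..<length xs}. Ks ! i \<otimes>\<^bsub>L\<^esub> xs ! i) = \<zero>\<^bsub>L\<^esub>"
        using combine_eq_finsum[OF Ks(1) _ xsL] Ks(2,3) subfieldE(3)[OF K] by auto
      show "xs ! i \<noteq> \<zero>\<^bsub>L\<^esub> \<and> xs ! i [^]\<^bsub>L\<^esub> N \<in> K" if "i \<in> {..<length xs}" for i
        using xsN that by simp
      fix i j k assume "i \<in> {..<length xs}" "j \<in> {..<length xs}" "i \<noteq> j" "k \<in> K"
      thus "xs ! i \<noteq> k \<otimes>\<^bsub>L\<^esub> xs ! j"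
        using independent_pair(2)[OF K Ai] xs by (simp add: nth_eq_iff_index_eq subset_iff)
    qed (use i in auto)
    hence "set Ks \<subseteq> {\<zero>\<^bsub>L\<^esub>}" using Ks(1) by (auto simp: in_set_conv_nth)
    \<comment> \<open>Nontriviality says only that \<open>set Ks\<close> differs from the singleton
      of zero, which leaves the empty list; but the empty list \<open>xs\<close> is
      independent.\<close>
    hence "Ks = []" using Ks(4) by (cases Ks) auto
    hence "xs = []" using Ks(1) by simp
    thus False using \<open>\<not> independent K xs\<close> by simp
  qed
qed

end
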